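(* Let $G$ be a finite group and let $S\subseteq G\setminus\{1\}$ be such that $S\cup S^{-1}\neq G\setminus\{1\}$ and $S\neq\emptyset$. Then the directed graph $\mathrm{Cay}(G,S)$ has a non-trivial bihomogeneous set if and only if there exists a subgroup $H$ of $G$, with $H\ne\{1\}$ and $H\neq G$, such that for every $g\in S\setminus H$ one has $HgH\subseteq S$.
   Context: $\mathrm{Cay}(G,S)$ is the simple digraph with vertex set $G$ and with an edge $xy$ from $x$ to $y$ iff $x^{-1}y\in S$ (here $S$ is not assumed to be closed under inverses). A set $H$ of vertices of a digraph $\Gamma$ is in-homogeneous if for every $v\in V(\Gamma)\setminus H$, either $vh$ is an edge for all $h\in H$ or $vh$ is not an edge for all $h\in H$; it is out-homogeneous if for every $v\in V(\Gamma)\setminus H$, either $hv$ is an edge for all $h\in H$ or $hv$ is not an edge for all $h\in H$; it is bihomogeneous if it is both. A bihomogeneous set is non-trivial if it contains at least two vertices and is not all of $V(\Gamma)$. *)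

theory Defs
  imports "HOL-Algebra.Coset" "Graph_Theory.Pair_Digraph"
begin

definition Cay :: "('a, 'b) monoid_scheme \<Rightarrow> 'a set \<Rightarrow> 'a pair_pre_digraph" where
  "Cay G S = \<lparr> pverts = carrier G,
     parcs = {(x, y). x \<in> carrier G \<and> y \<in> carrier G \<and> inv\<^bsub>G\<^esub> x \<otimes>\<^bsub>G\<^esub> y \<in> S} \<rparr>"

text \<open>Under the standing assumptions on \<open>S\<close>, the record \<open>Cay G S\<close> is a finite simple digraph.\<close>

lemma pair_digraph_Cay:
  assumes "group G" and "finite (carrier G)" and "S \<subseteq> carrier G - {\<one>\<^bsub>G\<^esub>}"
  shows "pair_digraph (Cay G S)"
proof -
  interpret group G by fact
  have "parcs (Cay G S) \<subseteq> carrier G \<times> carrier G"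
    by (auto simp: Cay_def)
  then have "finite (parcs (Cay G S))"
    using assms(2) by (meson finite_SigmaI finite_subset)
  then show ?thesis
    using assms(2,3) by unfold_locales (auto simp: Cay_def)
qed

definition in_homogeneous :: "'a pair_pre_digraph \<Rightarrow> 'a set \<Rightarrow> bool" where
  "in_homogeneous D H \<longleftrightarrow> H \<subseteq> pverts D \<and>
     (\<forall>v \<in> pverts D - H. (\<forall>h \<in> H. (v, h) \<in> parcs D) \<or> (\<forall>h \<in> H. (v, h) \<notin> parcs D))"

definition out_homogeneous :: "'a pair_pre_digraph \<Rightarrow> 'a set \<Rightarrow> bool" where
  "out_homogeneous D H \<longleftrightarrow> H \<subseteq> pverts D \<and>
     (\<forall>v \<in> pverts D - H. (\<forall>h \<in> H. (h, v) \<in> parcs D) \<or> (\<forall>h \<in> H. (h, v) \<notin> parcs D))"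

definition bihomogeneous :: "'a pair_pre_digraph \<Rightarrow> 'a set \<Rightarrow> bool" where
  "bihomogeneous D H \<longleftrightarrow> in_homogeneous D H \<and> out_homogeneous D H"

definition nontrivial_bihomogeneous :: "'a pair_pre_digraph \<Rightarrow> 'a set \<Rightarrow> bool" where
  "nontrivial_bihomogeneous D H \<longleftrightarrow>
     bihomogeneous D H \<and> (\<exists>x \<in> H. \<exists>y \<in> H. x \<noteq> y) \<and> H \<noteq> pverts D"

end

theory Submission
  imports Defs "HOL-Algebra.Generated_Groups"
begin

text \<open>
  Left translations are automorphisms of \<open>Cay G S\<close>. Take a non-trivial bihomogeneous set \<open>M\<close> that
  contains \<open>1\<close> and is as large as possible. If every translate of \<open>M\<close> equals \<open>M\<close> or is disjoint
  from it, then \<open>M\<close> is the required subgroup. Otherwise some translate \<open>gM\<close> overlaps \<open>M\<close>; the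
  union of two overlapping bihomogeneous sets is bihomogeneous, so \<open>M \<union> gM = G\<close> by maximality, and
  \<open>gM - M\<close>, the complement of \<open>M\<close>, is bihomogeneous as well. Hence the arcs from \<open>M\<close> to its
  complement are all present or all absent, and likewise for the arcs back. As right translation by
  an element of \<open>S\<close> is a permutation of the finite set \<open>G\<close>, no set is left by arcs without being
  entered by arcs, so both directions agree. If there are no arcs, \<open>S\<close> generates a proper
  subgroup; if all are present, the complement of \<open>S\<close> in \<open>G - {1}\<close> does.
\<close>

section \<open>Unions and differences of bihomogeneous sets in an arbitrary digraph\<close>

lemma bihomogeneous_iff:
  "bihomogeneous D H \<longleftrightarrow> H \<subseteq> pverts D \<and>
     (\<forall>v \<in> pverts D - H. \<forall>h \<in> H. \<forall>k \<in> H.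
        ((v, h) \<in> parcs D \<longleftrightarrow> (v, k) \<in> parcs D) \<and> ((h, v) \<in> parcs D \<longleftrightarrow> (k, v) \<in> parcs D))"
  unfolding bihomogeneous_def in_homogeneous_def out_homogeneous_def by blast

lemma bihomogeneousD:
  assumes "bihomogeneous D H" "v \<in> pverts D" "v \<notin> H" "h \<in> H" "k \<in> H"
  shows "(v, h) \<in> parcs D \<longleftrightarrow> (v, k) \<in> parcs D" and "(h, v) \<in> parcs D \<longleftrightarrow> (k, v) \<in> parcs D"
  using assms unfolding bihomogeneous_iff by blast+

text \<open>A common element \<open>c\<close> links the two sets: for a vertex outside both, its
  arcs to and from any member of either set agree with those at \<open>c\<close>.\<close>

lemma bihomogeneous_Un:
  assumes A: "bihomogeneous D A" and B: "bihomogeneous D B" and "A \<inter> B \<noteq> {}"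
  shows "bihomogeneous D (A \<union> B)"
proof -
  obtain c where c: "c \<in> A" "c \<in> B"
    using \<open>A \<inter> B \<noteq> {}\<close> by blast
  have "((v, h) \<in> parcs D \<longleftrightarrow> (v, c) \<in> parcs D) \<and> ((h, v) \<in> parcs D \<longleftrightarrow> (c, v) \<in> parcs D)"
    if "v \<in> pverts D - (A \<union> B)" "h \<in> A \<union> B" for v h
    using that c bihomogeneousD[OF A, of v h c] bihomogeneousD[OF B, of v h c] by blast
  moreover have "A \<union> B \<subseteq> pverts D"
    using A B by (auto simp: bihomogeneous_iff)
  ultimately show ?thesis
    unfolding bihomogeneous_iff by blast
qed

text \<open>Only vertices \<open>v\<close> in both sets need an argument. For them take
  \<open>b\<close> in \<open>B - A\<close>. As \<open>h\<close> lies outside \<open>B\<close>, its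
  arcs with \<open>v\<close> agree with its arcs with \<open>b\<close>; as \<open>b\<close> lies
  outside \<open>A\<close>, those agree for all \<open>h\<close> in \<open>A\<close>.\<close>

lemma bihomogeneous_Diff:
  assumes A: "bihomogeneous D A" and B: "bihomogeneous D B" and "B - A \<noteq> {}"
  shows "bihomogeneous D (A - B)"
proof -
  obtain b where b: "b \<in> B" "b \<notin> A"
    using \<open>B - A \<noteq> {}\<close> by blast
  have sub: "A \<subseteq> pverts D" "B \<subseteq> pverts D"
    using A B by (auto simp: bihomogeneous_iff)
  have "((v, h) \<in> parcs D \<longleftrightarrow> (v, k) \<in> parcs D) \<and> ((h, v) \<in> parcs D \<longleftrightarrow> (k, v) \<in> parcs D)"
    if v: "v \<in> pverts D - (A - B)" and h: "h \<in> A - B" and k: "k \<in> A - B" for v h k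
  proof (cases "v \<in> A")
    case False
    then show ?thesis
      using that bihomogeneousD[OF A, of v h k] by blast
  next
    case True
    then have "v \<in> B" using v by blast
    then show ?thesis
      using h k b sub bihomogeneousD[OF B, of h v b] bihomogeneousD[OF B, of k v b]
        bihomogeneousD[OF A, of b h k] by blast
  qed
  then show ?thesis
    using sub unfolding bihomogeneous_iff by blast
qed

text \<open>Change one endpoint at a time, passing through \<open>(a, b')\<close>: disjointness puts
  \<open>a\<close> outside \<open>B\<close> and \<open>b'\<close> outside \<open>A\<close>.\<close>

lemma bihomogeneous_pair_arcs:
  assumes "bihomogeneous D A" "bihomogeneous D B" "A \<inter> B = {}"
    and "a \<in> A" "b \<in> B" "a' \<in> A" "b' \<in> B"
  shows "(a, b) \<in> parcs D \<longleftrightarrow> (a', b') \<in> parcs D"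
proof -
  have "A \<subseteq> pverts D" "B \<subseteq> pverts D"
    using assms by (auto simp: bihomogeneous_iff)
  then show ?thesis
    using assms bihomogeneousD(1)[of D B a b b'] bihomogeneousD(2)[of D A b' a a'] by blast
qed

section \<open>Arcs and left translates in Cayley digraphs\<close>

lemma pverts_Cay [simp]: "pverts (Cay G S) = carrier G"
  by (simp add: Cay_def)

lemma parcs_Cay:
  "(x, y) \<in> parcs (Cay G S) \<longleftrightarrow> x \<in> carrier G \<and> y \<in> carrier G \<and> inv\<^bsub>G\<^esub> x \<otimes>\<^bsub>G\<^esub> y \<in> S"
  by (simp add: Cay_def)

context group
begin

lemma inv_mult_cancel_left:
  assumes "x \<in> carrier G" "y \<in> carrier G"
  shows "inv x \<otimes> (x \<otimes> y) = y" and "x \<otimes> (inv x \<otimes> y) = y"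
  using assms by (simp_all add: m_assoc[symmetric])

lemma subgroup_mult_left_iff:
  assumes "subgroup H G" "h \<in> H" "x \<in> carrier G"
  shows "h \<otimes> x \<in> H \<longleftrightarrow> x \<in> H"
proof
  interpret H: subgroup H G by fact
  show "x \<in> H" if "h \<otimes> x \<in> H"
    using that assms inv_mult_cancel_left(1)[of h x] H.m_closed[of "inv h" "h \<otimes> x"] by simp
  show "h \<otimes> x \<in> H" if "x \<in> H"
    using that assms by simp
qed

lemma subgroup_inv_mult_notin:
  assumes "subgroup H G" "h \<in> H" "v \<in> carrier G" "v \<notin> H"
  shows "inv h \<otimes> v \<notin> H" and "inv v \<otimes> h \<notin> H"
proof -
  interpret H: subgroup H G by fact
  show notin: "inv h \<otimes> v \<notin> H"
    using assms subgroup_mult_left_iff[of H "inv h" v] by simp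
  have "inv (inv v \<otimes> h) = inv h \<otimes> v"
    using assms by (simp add: inv_mult_group)
  then show "inv v \<otimes> h \<notin> H"
    using notin H.m_inv_closed[of "inv v \<otimes> h"] by auto
qed

lemma parcs_Cay_translate:
  assumes "g \<in> carrier G" "x \<in> carrier G" "y \<in> carrier G"
  shows "(g \<otimes> x, g \<otimes> y) \<in> parcs (Cay G S) \<longleftrightarrow> (x, y) \<in> parcs (Cay G S)"
proof -
  have "inv (g \<otimes> x) \<otimes> (g \<otimes> y) = inv x \<otimes> y"
    using assms by (simp add: inv_mult_group m_assoc inv_mult_cancel_left)
  then show ?thesis
    using assms by (simp add: parcs_Cay)
qed

lemma parcs_Cay_mult_right:
  assumes "x \<in> carrier G" "s \<in> carrier G"
  shows "(x, x \<otimes> s) \<in> parcs (Cay G S) \<longleftrightarrow> s \<in> S"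
proof -
  have "inv x \<otimes> (x \<otimes> s) = s"
    using assms by (simp add: inv_mult_cancel_left)
  then show ?thesis
    using assms by (simp add: parcs_Cay)
qed

lemma bihomogeneous_l_coset:
  assumes M: "bihomogeneous (Cay G S) M" and g: "g \<in> carrier G"
  shows "bihomogeneous (Cay G S) (g <# M)"
proof -
  have sub: "M \<subseteq> carrier G"
    using M by (simp add: bihomogeneous_iff)
  have "((v, h) \<in> parcs (Cay G S) \<longleftrightarrow> (v, k) \<in> parcs (Cay G S)) \<and>
        ((h, v) \<in> parcs (Cay G S) \<longleftrightarrow> (k, v) \<in> parcs (Cay G S))"
    if v: "v \<in> carrier G" "v \<notin> g <# M" and hk: "h \<in> g <# M" "k \<in> g <# M" for v h k
  proof -
    obtain x y where xy: "x \<in> M" "y \<in> M" "h = g \<otimes> x" "k = g \<otimes> y"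
      using hk unfolding l_coset_def by blast
    define w where "w = inv g \<otimes> v"
    have w: "w \<in> carrier G" "v = g \<otimes> w"
      using v g by (simp_all add: w_def inv_mult_cancel_left)
    then have "w \<notin> M"
      using v unfolding l_coset_def by blast
    with w xy sub g show ?thesis
      using bihomogeneousD[OF M, of w x y] parcs_Cay_translate by auto
  qed
  moreover have "g <# M \<subseteq> carrier G"
    using l_coset_subset_G[OF sub g] .
  ultimately show ?thesis
    unfolding bihomogeneous_iff pverts_Cay by blast
qed

lemma card_l_coset:
  assumes "M \<subseteq> carrier G" "g \<in> carrier G"
  shows "card (g <# M) = card M"
proof -
  have "g <# M = (\<lambda>x. g \<otimes> x) ` M"
    by (auto simp: l_coset_def)
  moreover have "inj_on (\<lambda>x. g \<otimes> x) M"
    using assms by (intro inj_on_inverseI[where g = "\<lambda>x. inv g \<otimes> x"]) (auto simp: inv_mult_cancel_left)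
  ultimately show ?thesis
    by (simp add: card_image)
qed

section \<open>Subgroups as bihomogeneous sets\<close>

lemma bihomogeneous_subgroup_iff:
  assumes H: "subgroup H G" and S: "S \<subseteq> carrier G"
  shows "bihomogeneous (Cay G S) H \<longleftrightarrow> (\<forall>g \<in> S - H. (H #> g) <#> H \<subseteq> S)"
proof
  interpret H: subgroup H G by fact
  assume B: "bihomogeneous (Cay G S) H"
  \<comment> \<open>Out-homogeneity yields the left factor of the double coset:
    \<open>h \<otimes> s \<in> S\<close> says that there is an arc from \<open>inv h\<close> to
    \<open>s\<close>, to be compared with the arc from \<open>\<one>\<close> to
    \<open>s\<close>.\<close>
  have left: "h \<otimes> s \<in> S" if "h \<in> H" "s \<in> S" "s \<notin> H" for h s
    using that S bihomogeneousD(2)[OF B, of s \<one> "inv h"] by (auto simp: parcs_Cay)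
  \<comment> \<open>In-homogeneity yields the right factor, seen from the vertex
    \<open>inv s\<close>: its arc to \<open>h\<close> is compared with its arc to
    \<open>\<one>\<close>.\<close>
  have right: "s \<otimes> h \<in> S" if "h \<in> H" "s \<in> S" "s \<notin> H" for h s
  proof -
    have "inv s \<notin> H"
      using that S by (metis H.m_inv_closed inv_inv subsetD)
    then show ?thesis
      using that S bihomogeneousD(1)[OF B, of "inv s" \<one> h] by (auto simp: parcs_Cay)
  qed
  show "\<forall>g \<in> S - H. (H #> g) <#> H \<subseteq> S"
  proof (clarsimp simp: r_coset_def set_mult_def)
    fix g h k assume g: "g \<in> S" "g \<notin> H" and h: "h \<in> H" and k: "k \<in> H"
    have "h \<otimes> g \<notin> H"
      using subgroup_mult_left_iff[OF H h, of g] g S by blast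
    then show "h \<otimes> g \<otimes> k \<in> S"
      using left right g h k by blast
  qed
next
  interpret H: subgroup H G by fact
  assume dc: "\<forall>g \<in> S - H. (H #> g) <#> H \<subseteq> S"
  have dc': "h \<otimes> g \<otimes> k \<in> S" if "g \<in> S" "g \<notin> H" "h \<in> H" "k \<in> H" for g h k
    using dc that by (fastforce simp: r_coset_def set_mult_def)
  \<comment> \<open>Moving the endpoint from \<open>h\<close> to \<open>k\<close> multiplies
    \<open>inv v \<otimes> h\<close> on the right by \<open>inv h \<otimes> k\<close>, which stays
    in the double coset. In \<open>out\<close> the factor \<open>inv k \<otimes> h\<close> appears
    on the left.\<close>
  have into: "inv v \<otimes> k \<in> S"
    if v: "v \<in> carrier G" "v \<notin> H" and h: "h \<in> H" and k: "k \<in> H" and s: "inv v \<otimes> h \<in> S" for v h k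
  proof -
    have "\<one> \<otimes> (inv v \<otimes> h) \<otimes> (inv h \<otimes> k) \<in> S"
      using dc'[OF s subgroup_inv_mult_notin(2)[OF H h v]] h k by simp
    then show ?thesis
      using v h k by (simp add: m_assoc inv_mult_cancel_left)
  qed
  have out: "inv k \<otimes> v \<in> S"
    if v: "v \<in> carrier G" "v \<notin> H" and h: "h \<in> H" and k: "k \<in> H" and s: "inv h \<otimes> v \<in> S" for v h k
  proof -
    have "(inv k \<otimes> h) \<otimes> (inv h \<otimes> v) \<otimes> \<one> \<in> S"
      using dc'[OF s subgroup_inv_mult_notin(1)[OF H h v], of "inv k \<otimes> h" \<one>] h k by simp
    then show ?thesis
      using v h k by (simp add: m_assoc inv_mult_cancel_left)
  qed
  show "bihomogeneous (Cay G S) H"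
    unfolding bihomogeneous_iff
  proof (intro conjI ballI)
    fix v h k assume "v \<in> pverts (Cay G S) - H" and hk: "h \<in> H" "k \<in> H"
    then have v: "v \<in> carrier G" "v \<notin> H" by auto
    show "(v, h) \<in> parcs (Cay G S) \<longleftrightarrow> (v, k) \<in> parcs (Cay G S)"
      using into[OF v hk] into[OF v hk(2,1)] v hk by (auto simp: parcs_Cay)
    show "(h, v) \<in> parcs (Cay G S) \<longleftrightarrow> (k, v) \<in> parcs (Cay G S)"
      using out[OF v hk] out[OF v hk(2,1)] v hk by (auto simp: parcs_Cay)
  qed (use H.subset in simp)
qed

text \<open>For \<open>x\<close> in \<open>M\<close> the translate \<open>x <# M\<close> contains
  \<open>x\<close>, so it meets \<open>M\<close> and equals it. This gives closure under products,
  and \<open>\<one>\<close> being in \<open>x <# M\<close> gives inverses.\<close>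

lemma subgroup_if_block:
  assumes "M \<subseteq> carrier G" "\<one> \<in> M"
    and block: "\<And>g. \<lbrakk>g \<in> carrier G; (g <# M) \<inter> M \<noteq> {}\<rbrakk> \<Longrightarrow> g <# M = M"
  shows "subgroup M G"
proof -
  have stab: "x <# M = M" if "x \<in> M" for x
  proof (rule block)
    show "x \<in> carrier G" using that assms by blast
    then have "x \<in> x <# M"
      using assms(2) by (force simp: l_coset_def)
    then show "(x <# M) \<inter> M \<noteq> {}" using that by blast
  qed
  show ?thesis
  proof (rule subgroupI)
    show "M \<subseteq> carrier G" "M \<noteq> {}" using assms by auto
    fix x assume x: "x \<in> M"
    then obtain y where y: "y \<in> M" "x \<otimes> y = \<one>"
      using stab[OF x] assms(2) by (force simp: l_coset_def)
    then show "inv x \<in> M"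
      using x assms(1) by (metis inv_equality inv_inv inv_closed subsetD)
    fix z assume "z \<in> M"
    then show "x \<otimes> z \<in> M"
      using stab[OF x] by (auto simp: l_coset_def)
  qed
qed

section \<open>Generated subgroups and complementary bihomogeneous sets\<close>

lemma generate_neq_carrier_if_no_cut_arcs:
  assumes T: "T \<subseteq> carrier G" and C: "C \<subseteq> carrier G" "C \<noteq> {}" "C \<noteq> carrier G"
    and cut: "\<And>a c. \<lbrakk>a \<in> carrier G - C; c \<in> C\<rbrakk> \<Longrightarrow> inv a \<otimes> c \<notin> T \<and> inv c \<otimes> a \<notin> T"
  shows "generate G T \<noteq> carrier G"
proof
  \<comment> \<open>Right multiplication by a generator follows an arc of \<open>Cay G T\<close>
    forwards, by its inverse backwards. With no arcs either way between \<open>C\<close> and its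
    complement, such a walk never leaves \<open>C\<close>; if \<open>T\<close> generated
    \<open>G\<close>, it could reach every element.\<close>
  have mult: "c \<otimes> x \<in> C" if "x \<in> generate G T" "c \<in> C" for x c
    using that
  proof (induction arbitrary: c)
    case one
    then show ?case using C by auto
  next
    case (incl t)
    then have "inv c \<otimes> (c \<otimes> t) = t"
      using T C by (intro inv_mult_cancel_left) auto
    then show ?case
      using cut[of "c \<otimes> t" c] incl T C by auto
  next
    case (inv t)
    then have "inv (c \<otimes> inv t) \<otimes> c = t"
      using T C by (simp add: inv_mult_group m_assoc subset_iff)
    then show ?case
      using cut[of "c \<otimes> inv t" c] inv T C by auto
  next
    case (eng x y)
    then have "x \<in> carrier G" "y \<in> carrier G"
      using generate_in_carrier[OF T] by auto
    then show ?case
      using eng C by (metis m_assoc subsetD)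
  qed
  assume gen: "generate G T = carrier G"
  obtain c where c: "c \<in> C" using C by blast
  have "x \<in> C" if "x \<in> carrier G" for x
  proof -
    have "c \<otimes> (inv c \<otimes> x) \<in> C"
      using mult[of "inv c \<otimes> x" c] c C that gen by auto
    then show ?thesis
      using c C that by (simp add: inv_mult_cancel_left subset_iff)
  qed
  then show False using C by blast
qed

lemma generate_neq_one:
  assumes "x \<in> T" "x \<noteq> \<one>"
  shows "generate G T \<noteq> {\<one>}"
  using assms generate.incl[of x T G] by auto

text \<open>Right multiplication by \<open>s\<close> in \<open>S\<close> maps \<open>A\<close> into
  itself, hence onto itself by finiteness. An arc from \<open>c\<close> into \<open>A\<close> would
  then give an element of \<open>A\<close> a second preimage \<open>c\<close> outside
  \<open>A\<close>, against injectivity.\<close>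

lemma no_arcs_into_if_no_arcs_out:
  assumes fin: "finite (carrier G)" and A: "A \<subseteq> carrier G"
    and out: "\<And>a c. \<lbrakk>a \<in> A; c \<in> carrier G - A\<rbrakk> \<Longrightarrow> (a, c) \<notin> parcs (Cay G S)"
    and c: "c \<in> carrier G - A" and a: "a \<in> A"
  shows "(c, a) \<notin> parcs (Cay G S)"
proof
  assume arc: "(c, a) \<in> parcs (Cay G S)"
  define s where "s = inv c \<otimes> a"
  have s: "s \<in> S" "s \<in> carrier G" and cs: "c \<otimes> s = a"
    using arc a c A by (auto simp: s_def parcs_Cay inv_mult_cancel_left)
  have "(\<lambda>x. x \<otimes> s) ` A \<subseteq> A"
  proof clarify
    fix x assume "x \<in> A"
    then show "x \<otimes> s \<in> A"
      using out[of x "x \<otimes> s"] parcs_Cay_mult_right[of x s S] s A by blast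
  qed
  moreover have inj: "inj_on (\<lambda>x. x \<otimes> s) (carrier G)"
    using s by (simp add: inj_on_def)
  ultimately have "(\<lambda>x. x \<otimes> s) ` A = A"
    using fin A by (meson endo_inj_surj finite_subset inj_on_subset)
  then obtain b where "b \<in> A" "b \<otimes> s = c \<otimes> s"
    using a cs by (metis imageE)
  then show False
    using inj A c by (auto dest: inj_onD)
qed

lemma subgroup_if_complementary_bihomogeneous:
  assumes fin: "finite (carrier G)" and S: "S \<subseteq> carrier G - {\<one>}"
    and ne: "S \<noteq> {}" "S \<noteq> carrier G - {\<one>}"
    and M: "bihomogeneous (Cay G S) M" and C: "bihomogeneous (Cay G S) (carrier G - M)"
    and M_ne: "M \<noteq> {}" "M \<noteq> carrier G"
  shows "\<exists>H. subgroup H G \<and> H \<noteq> {\<one>} \<and> H \<noteq> carrier G \<and> (\<forall>g \<in> S - H. (H #> g) <#> H \<subseteq> S)"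
proof -
  let ?C = "carrier G - M" and ?E = "parcs (Cay G S)"
  have sub: "M \<subseteq> carrier G"
    using M by (simp add: bihomogeneous_iff)
  obtain m c where m: "m \<in> M" and c: "c \<in> ?C"
    using M_ne sub by blast
  have MC: "(x, y) \<in> ?E \<longleftrightarrow> (m, c) \<in> ?E" if "x \<in> M" "y \<in> ?C" for x y
    using bihomogeneous_pair_arcs[OF M C, of x y m c] that m c by blast
  have CM: "(y, x) \<in> ?E \<longleftrightarrow> (c, m) \<in> ?E" if "x \<in> M" "y \<in> ?C" for x y
    using bihomogeneous_pair_arcs[OF C M, of y x c m] that m c by blast
  \<comment> \<open>Arcs in a given direction between the two sides are all present or all absent,
    so one missing arc means that a side has no outgoing arcs. Each implication is the
    contrapositive, applied to \<open>?C\<close> and to \<open>M\<close> respectively.\<close>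
  have sym: "(m, c) \<in> ?E \<longleftrightarrow> (c, m) \<in> ?E"
  proof
    assume "(m, c) \<in> ?E"
    then show "(c, m) \<in> ?E"
      using no_arcs_into_if_no_arcs_out[OF fin, of ?C S m c] CM m c sub by blast
  next
    assume "(c, m) \<in> ?E"
    then show "(m, c) \<in> ?E"
      using no_arcs_into_if_no_arcs_out[OF fin, of M S c m] MC m c sub by blast
  qed
  show ?thesis
  proof (cases "(m, c) \<in> ?E")
    case False
    let ?H = "generate G S"
    have S': "S \<subseteq> carrier G" using S by blast
    have "?H \<noteq> carrier G"
    proof (rule generate_neq_carrier_if_no_cut_arcs[OF S' sub M_ne])
      fix a x assume ax: "a \<in> ?C" "x \<in> M"
      then have "(x, a) \<notin> ?E" "(a, x) \<notin> ?E"
        using MC CM False sym by blast+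
      then show "inv a \<otimes> x \<notin> S \<and> inv x \<otimes> a \<notin> S"
        using ax sub by (auto simp: parcs_Cay)
    qed
    moreover have "?H \<noteq> {\<one>}"
      using generate_neq_one S ne(1) by blast
    \<comment> \<open>The double coset condition is vacuous here.\<close>
    moreover have "S - ?H = {}"
      by (auto intro: generate.incl)
    ultimately show ?thesis
      using generate_is_subgroup[OF S'] by blast
  next
    case True
    \<comment> \<open>All arcs of \<open>Cay G S\<close> across the cut are present, so
      \<open>Cay G T\<close> has none there. \<open>T\<close> is non-empty because \<open>S\<close>
      is not all of \<open>carrier G - {\<one>}\<close>.\<close>
    define T where "T = carrier G - {\<one>} - S"
    let ?H = "generate G T"
    have T: "T \<subseteq> carrier G" by (auto simp: T_def)
    interpret H: subgroup ?H G
      by (rule generate_is_subgroup[OF T])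
    have "?H \<noteq> carrier G"
    proof (rule generate_neq_carrier_if_no_cut_arcs[OF T sub M_ne])
      fix a x assume ax: "a \<in> ?C" "x \<in> M"
      then have "(x, a) \<in> ?E" "(a, x) \<in> ?E"
        using MC CM True sym by blast+
      then show "inv a \<otimes> x \<notin> T \<and> inv x \<otimes> a \<notin> T"
        using ax sub by (auto simp: parcs_Cay T_def)
    qed
    moreover have "?H \<noteq> {\<one>}"
      using generate_neq_one[of _ T] S ne(2) by (auto simp: T_def)
    moreover have "bihomogeneous (Cay G S) ?H"
    proof -
      \<comment> \<open>Everything outside \<open>?H\<close> lies in \<open>S\<close>, so each
        vertex outside \<open>?H\<close> has arcs to and from all of \<open>?H\<close>.\<close>
      have S_iff: "x \<in> S" if "x \<in> carrier G" "x \<notin> ?H" for x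
        using that generate.incl[of x T G] H.one_closed by (auto simp: T_def)
      have "(v, h) \<in> ?E \<and> (h, v) \<in> ?E" if "v \<in> carrier G - ?H" "h \<in> ?H" for v h
        using that S_iff H.subset subgroup_inv_mult_notin[OF H.subgroup_axioms, of h v]
        by (auto simp: parcs_Cay)
      then show ?thesis
        using H.subset unfolding bihomogeneous_iff by simp
    qed
    ultimately show ?thesis
      using bihomogeneous_subgroup_iff[OF H.subgroup_axioms, of S] H.subgroup_axioms S by blast
  qed
qed

section \<open>Maximal bihomogeneous sets containing the identity, and the main equivalence\<close>

lemma exists_maximal_nontrivial_bihomogeneous:
  assumes fin: "finite (carrier G)" and B: "nontrivial_bihomogeneous (Cay G S) B"
  obtains M where "nontrivial_bihomogeneous (Cay G S) M" "\<one> \<in> M"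
    "\<And>N. \<lbrakk>nontrivial_bihomogeneous (Cay G S) N; \<one> \<in> N\<rbrakk> \<Longrightarrow> card N \<le> card M"
proof -
  let ?P = "\<lambda>M. nontrivial_bihomogeneous (Cay G S) M \<and> \<one> \<in> M"
  have sub: "N \<subseteq> carrier G" if "nontrivial_bihomogeneous (Cay G S) N" for N
    using that by (auto simp: nontrivial_bihomogeneous_def bihomogeneous_iff)
  obtain x y where xy: "x \<in> B" "y \<in> B" "x \<noteq> y"
    using B by (auto simp: nontrivial_bihomogeneous_def)
  have x: "x \<in> carrier G" "y \<in> carrier G" using sub[OF B] xy by auto
  \<comment> \<open>Translating by the inverse of a member brings \<open>\<one>\<close> into the
    set; the cardinality is preserved, so the translate is still proper.\<close>
  let ?N = "inv x <# B"
  have N: "\<one> \<in> ?N" "inv x \<otimes> y \<in> ?N"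
    using xy x l_inv[of x] by (force simp: l_coset_def)+
  have neq: "\<one> \<noteq> inv x \<otimes> y"
    using x xy by (metis inv_mult_cancel_left(2) r_one)
  have "card ?N = card B"
    using card_l_coset[OF sub[OF B]] x by simp
  moreover have "card B \<noteq> card (carrier G)"
    using card_subset_eq[OF fin sub[OF B]] B by (auto simp: nontrivial_bihomogeneous_def)
  ultimately have "?N \<noteq> pverts (Cay G S)"
    by auto
  moreover have "bihomogeneous (Cay G S) ?N"
    using bihomogeneous_l_coset B x by (simp add: nontrivial_bihomogeneous_def)
  ultimately have "?P ?N"
    using N neq unfolding nontrivial_bihomogeneous_def by blast
  moreover have "\<forall>N. ?P N \<longrightarrow> card N < Suc (card (carrier G))"
    using card_mono[OF fin sub] by (simp add: less_Suc_eq_le)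
  ultimately have "\<exists>M. ?P M \<and> (\<forall>N. ?P N \<longrightarrow> card N \<le> card M)"
    by (rule ex_has_greatest_nat)
  then show ?thesis
    using that by blast
qed

lemma subgroup_if_nontrivial_bihomogeneous:
  assumes fin: "finite (carrier G)" and S: "S \<subseteq> carrier G - {\<one>}"
    and ne: "S \<noteq> {}" "S \<noteq> carrier G - {\<one>}"
    and B: "nontrivial_bihomogeneous (Cay G S) B"
  shows "\<exists>H. subgroup H G \<and> H \<noteq> {\<one>} \<and> H \<noteq> carrier G \<and> (\<forall>g \<in> S - H. (H #> g) <#> H \<subseteq> S)"
proof -
  obtain M where M: "nontrivial_bihomogeneous (Cay G S) M" "\<one> \<in> M"
    and max: "\<And>N. \<lbrakk>nontrivial_bihomogeneous (Cay G S) N; \<one> \<in> N\<rbrakk> \<Longrightarrow> card N \<le> card M"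
    using exists_maximal_nontrivial_bihomogeneous[OF fin B] by blast
  have bM: "bihomogeneous (Cay G S) M" and M_ne: "M \<noteq> {}" "M \<noteq> {\<one>}" "M \<noteq> carrier G"
    using M by (auto simp: nontrivial_bihomogeneous_def)
  have sub: "M \<subseteq> carrier G"
    using bM by (simp add: bihomogeneous_iff)
  then have finM: "finite M" using fin finite_subset by blast
  show ?thesis
  proof (cases "\<forall>g \<in> carrier G. (g <# M) \<inter> M \<noteq> {} \<longrightarrow> g <# M = M")
    case True
    then have "subgroup M G"
      using subgroup_if_block[OF sub M(2)] by blast
    then show ?thesis
      using bihomogeneous_subgroup_iff[of M S] S bM M_ne by blast
  next
    case False
    then obtain g where g: "g \<in> carrier G" "(g <# M) \<inter> M \<noteq> {}" "g <# M \<noteq> M"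
      by blast
    let ?N = "g <# M"
    have bN: "bihomogeneous (Cay G S) ?N"
      using bihomogeneous_l_coset[OF bM g(1)] .
    have subN: "?N \<subseteq> carrier G"
      using bN by (simp add: bihomogeneous_iff)
    have finN: "finite ?N" using subN fin finite_subset by blast
    have cardN: "card ?N = card M"
      using card_l_coset[OF sub g(1)] .
    \<comment> \<open>Distinct finite sets of equal size do not contain each other. Hence the union
      is strictly larger than \<open>M\<close>, and \<open>M - ?N\<close> is non-empty, as needed
      for the difference \<open>?N - M\<close>.\<close>
    have NM: "\<not> M \<subseteq> ?N" "\<not> ?N \<subseteq> M"
      using card_subset_eq[OF finN] card_subset_eq[OF finM] cardN g(3) by auto
    have "bihomogeneous (Cay G S) (?N \<union> M)"
      using bihomogeneous_Un[OF bN bM g(2)] .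
    moreover have "card M < card (?N \<union> M)"
      using NM finM finN by (intro psubset_card_mono) auto
    moreover have "\<exists>x \<in> ?N \<union> M. \<exists>y \<in> ?N \<union> M. x \<noteq> y"
      using M(1) by (auto simp: nontrivial_bihomogeneous_def)
    \<comment> \<open>Were the union proper, it would be a non-trivial bihomogeneous set containing
      \<open>\<one>\<close> and larger than \<open>M\<close>.\<close>
    ultimately have "?N \<union> M = carrier G"
      using max[of "?N \<union> M"] M(2) by (auto simp: nontrivial_bihomogeneous_def)
    then have "carrier G - M = ?N - M" by blast
    then have "bihomogeneous (Cay G S) (carrier G - M)"
      using bihomogeneous_Diff[OF bN bM] NM by auto
    then show ?thesis
      using subgroup_if_complementary_bihomogeneous[OF fin S ne bM] M_ne by blast
  qed
qed

end

theorem theorem3p8: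
  fixes G :: "('a, 'b) monoid_scheme" (structure) and S :: "'a set"
  assumes "group G" and "finite (carrier G)"
    and "S \<subseteq> carrier G - {\<one>}"
    and "S \<union> set_inv S \<noteq> carrier G - {\<one>}"
    and "S \<noteq> {}"
  shows "(\<exists>B. nontrivial_bihomogeneous (Cay G S) B) \<longleftrightarrow>
    (\<exists>H. subgroup H G \<and> H \<noteq> {\<one>} \<and> H \<noteq> carrier G \<and>
      (\<forall>g \<in> S - H. (H #> g) <#> H \<subseteq> S))"
proof -
  interpret group G by fact
  have "S \<noteq> carrier G - {\<one>}"
  proof
    assume "S = carrier G - {\<one>}"
    then have "S \<union> set_inv S = carrier G - {\<one>}"
      by (auto simp: SET_INV_def)
    with assms(4) show False ..
  qed
  \<comment> \<open>For the converse, the subgroup itself is the bihomogeneous set.\<close>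
  moreover have "nontrivial_bihomogeneous (Cay G S) H"
    if "subgroup H G" "H \<noteq> {\<one>}" "H \<noteq> carrier G" "\<forall>g \<in> S - H. (H #> g) <#> H \<subseteq> S" for H
  proof -
    have "\<one> \<in> H"
      using that(1) by (rule subgroup.one_closed)
    then have "\<exists>x \<in> H. \<exists>y \<in> H. x \<noteq> y"
      using that(2) by blast
    then show ?thesis
      using bihomogeneous_subgroup_iff[OF that(1), of S] that assms(3)
      unfolding nontrivial_bihomogeneous_def by auto
  qed
  ultimately show ?thesis
    using subgroup_if_nontrivial_bihomogeneous[OF assms(2,3,5)] by blast
qed

end
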